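(* Consider a clustering problem with clean data points $X_1,\dots,X_n\in\mathbb{R}^d$, $\|X_i\|\le1$, noisy data points $Z_1,\dots,Z_n$, and underlying true division $\mathcal C=\{\mathcal C_1,\dots,\mathcal C_K\}$ into $K$ clusters. Let $\hat X$ be the denoised data matrix obtained from the noisy data and suppose $\|\hat X-X\|_{2,\infty}\le\epsilon$. Let $\hat{\mathcal C}$, with corresponding centers $\hat m=(\hat m_1,\dots,\hat m_K)$, be the minimizer of the loss function $\hat f(\mathcal C,m)$ over divisions and centers. Then: (1) $\hat{\mathcal C}$ almost minimizes the loss function with clean data: for centers $m=(m_1,\dots,m_K)$, $$f(\hat{\mathcal C},\hat m)\le f(\mathcal C,m)+4\epsilon.$$ (2) Furthermore, suppose that under the true division $\mathcal C$ there are centers $m_1,\dots,m_K\in\mathbb{R}^d$ and absolute constants $c_0,\delta,c_m$ such that: $|\mathcal C_k|\ge c_0n$ for all $k\in[K]$; $\|X_i-m_k\|\le\delta$ for all $k\in[K]$ and $i\in\mathcal C_k$; $\|m_j-m_k\|\ge c_m$ for all $1\le j\ne k\le K$; and $$c_m>2\left(\delta+\epsilon+2\sqrt{2(\delta^2+\epsilon^2)/c_0}\right).$$ Then $k$-means gives a perfect clustering result, i.e. the division $\hat{\mathcal C}$ is exactly the same as $\mathcal C$.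
   Context: The data matrices are $X=[X_1,\dots,X_n]^T$, $Z=[Z_1,\dots,Z_n]^T$ with $Z_i=X_i+\xi_i$ ($\xi_i$ noise), and $\hat X=[\hat X_1,\dots,\hat X_n]^T$ is the PCA-denoised matrix $\hat X=Z\hat V_r\hat V_r^T$, where $\hat V_r$ consists of the first $r$ right singular vectors of $Z$ ($r$ being the rank of $X$). A division $\mathcal C=\{\mathcal C_1,\dots,\mathcal C_K\}$ is a partition of $[n]=\{1,\dots,n\}$, where $\mathcal C_k$ is the index set of the data points in the $k$-th cluster; divisions are compared as partitions (up to relabeling the clusters). For a division $\mathcal C$ and centers $m=(m_1,\dots,m_K)$, $m_k\in\mathbb{R}^d$, the $k$-means losses with clean and denoised data are $$f(\mathcal C,m)=\frac1n\sum_{k\in[K]}\sum_{i\in\mathcal C_k}\|X_i-m_k\|^2,\qquad \hat f(\mathcal C,m)=\frac1n\sum_{k\in[K]}\sum_{i\in\mathcal C_k}\|\hat X_i-m_k\|^2.$$ For a matrix $A$ with rows $A_i$, $\|A\|_{2,\infty}=\max_i\|A_i\|$, with $\|\cdot\|$ the Euclidean norm.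
   Formalization: Part (1) is proved for ε ≤ 2+√3; for every larger ε it is false as stated (d=1, n=4, K=2, X=(1,1,−1,−1), noise ε(1,−1,1,−1) gives clean loss 1+ε² > 4ε against 0). In part (2) c_0 is taken positive. *)

theory Defs
  imports "HOL-Analysis.Analysis" "HOL-Library.Disjoint_Sets"
begin

text \<open>
  Data matrices have type \<open>real ^ 'd ^ 'n\<close>: there are \<open>n = CARD('n)\<close> data points in dimension
  \<open>d = CARD('d)\<close>, and the \<open>i\<close>-th data point is the row \<open>X $ i\<close>. Clusters are labelled by a finite
  type \<open>'k\<close>, so that \<open>K = CARD('k)\<close>.
\<close>

definition norm_2_inf :: "real ^ 'd ^ 'n \<Rightarrow> real" where
  "norm_2_inf A = Max (range (\<lambda>i. norm (A $ i)))"

text \<open>The rank-one matrix \<open>a b\<^sup>T\<close>.\<close>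

definition outer :: "real ^ 'n \<Rightarrow> real ^ 'd \<Rightarrow> real ^ 'd ^ 'n" where
  "outer a b = (columnvector a :: real ^ 1 ^ 'n) ** (rowvector b :: real ^ 'd ^ 1)"

text \<open>
  Thin singular value decomposition \<open>Z = (\<Sum>j<min n d. \<sigma>\<^sub>j u\<^sub>j v\<^sub>j\<^sup>T)\<close>. The values of \<open>\<sigma>\<close>, \<open>u\<close> and \<open>v\<close> at
  indices \<open>\<ge> min n d\<close> play no role. Singular vectors are not unique, hence a predicate.
\<close>

definition is_svd ::
  "real ^ 'd ^ 'n \<Rightarrow> (nat \<Rightarrow> real) \<Rightarrow> (nat \<Rightarrow> real ^ 'n) \<Rightarrow> (nat \<Rightarrow> real ^ 'd) \<Rightarrow> bool" where
  "is_svd Z \<sigma> u v \<longleftrightarrow>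
     (let q = min CARD('n) CARD('d) in
       (\<forall>i<q. \<forall>j<q. u i \<bullet> u j = (if i = j then 1 else 0)) \<and>
       (\<forall>i<q. \<forall>j<q. v i \<bullet> v j = (if i = j then 1 else 0)) \<and>
       (\<forall>j<q. 0 \<le> \<sigma> j) \<and>
       (\<forall>i<q. \<forall>j<q. i \<le> j \<longrightarrow> \<sigma> j \<le> \<sigma> i) \<and>
       Z = (\<Sum>j<q. \<sigma> j *\<^sub>R outer (u j) (v j)))"

text \<open>
  \<open>Z V\<^sub>r V\<^sub>r\<^sup>T\<close>, where \<open>V\<^sub>r\<close> has columns \<open>v 0, \<dots>, v (r - 1)\<close>; the product \<open>V\<^sub>r V\<^sub>r\<^sup>T\<close> is written as a sum of
  outer products because \<open>r\<close> is a number rather than a type.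
\<close>

definition pca_denoise :: "nat \<Rightarrow> (nat \<Rightarrow> real ^ 'd) \<Rightarrow> real ^ 'd ^ 'n \<Rightarrow> real ^ 'd ^ 'n" where
  "pca_denoise r v Z = Z ** (\<Sum>j<r. outer (v j) (v j))"

text \<open>
  A labelled division; \<^const>\<open>partition_on\<close> makes every cluster nonempty. The underlying unlabelled
  partition is \<open>range C\<close>.
\<close>

definition is_division :: "('k::finite \<Rightarrow> 'n::finite set) \<Rightarrow> bool" where
  "is_division C \<longleftrightarrow> inj C \<and> partition_on UNIV (range C)"

definition kmeans_loss ::
  "real ^ 'd ^ 'n \<Rightarrow> ('k::finite \<Rightarrow> 'n set) \<Rightarrow> ('k \<Rightarrow> real ^ 'd) \<Rightarrow> real" where
  "kmeans_loss X C m = (1 / real CARD('n)) * (\<Sum>k\<in>UNIV. \<Sum>i\<in>C k. (norm (X $ i - m k))\<^sup>2)"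

definition kmeans_minimizer ::
  "real ^ 'd ^ 'n \<Rightarrow> ('k::finite \<Rightarrow> 'n set) \<Rightarrow> ('k \<Rightarrow> real ^ 'd) \<Rightarrow> bool" where
  "kmeans_minimizer X C m \<longleftrightarrow>
     is_arg_min (\<lambda>(C, m). kmeans_loss X C m) (\<lambda>(C, m). is_division C) (C, m)"

end

theory Submission
  imports Defs
begin

text \<open>
  Write \<open>x\<^sub>i\<close> and \<open>y\<^sub>i\<close> for the clean and the denoised points and \<open>e\<^sub>i = y\<^sub>i - x\<^sub>i\<close>, so that
  \<open>\<parallel>e\<^sub>i\<parallel> \<le> \<epsilon>\<close>.

  For the first part, let \<open>a\<^sub>i\<close> be the estimated center of the \<open>i\<close>-th point and \<open>b\<^sub>i\<close> its center
  under the other division. Passing from clean to denoised data, comparing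
  there by minimality, and passing back, costs exactly \<open>2 (a\<^sub>i - b\<^sub>i) \<bullet> e\<^sub>i\<close> per point. Bounding
  \<open>\<parallel>a\<^sub>i\<parallel>\<close> and \<open>\<parallel>b\<^sub>i\<parallel>\<close> separately would give the constant \<open>4\<epsilon> + 2\<epsilon>\<^sup>2\<close>, which is too large. Instead
  the \<open>b\<^sub>i\<close> may be taken to be the cluster means \<open>P x\<close>, and minimality forces the \<open>a\<^sub>i\<close> to be the
  cluster means \<open>Q y = Q x + Q e\<close>, where \<open>P\<close> and \<open>Q\<close> are the orthogonal projections that average
  over clusters. Now \<open>2 (Q - P) = (2Q - 1) - (2P - 1)\<close> is a difference of two isometries, so
  \<open>2 (Q - P) x \<bullet> e\<close> costs only \<open>2\<epsilon>\<close> per point on average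
  (as \<open>\<parallel>x\<^sub>i\<parallel> \<le> 1\<close>), and \<open>2 Q e \<bullet> e\<close> costs at most \<open>2\<epsilon>\<^sup>2\<close>.
  This proves the claim for \<open>\<epsilon> \<le> 1\<close>. For larger \<open>\<epsilon>\<close> the loss of the estimate is itself at most
  \<open>1 + \<epsilon>\<^sup>2\<close>, and \<open>1 + \<epsilon>\<^sup>2 \<le> 4\<epsilon>\<close> holds precisely for \<open>2 - sqrt 3 \<le> \<epsilon> \<le> 2 + sqrt 3\<close>.

  For the second part, put \<open>s = sqrt (2 (\<delta>\<^sup>2 + \<epsilon>\<^sup>2) / c\<^sub>0)\<close>. The true division with the true centers
  has denoised loss at most \<open>(\<delta> + \<epsilon>)\<^sup>2 \<le> c\<^sub>0 s\<^sup>2\<close>. A true center with no estimated center within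
  \<open>\<delta> + \<epsilon> + s\<close> would give each of the \<open>c\<^sub>0 n\<close> points of its cluster a loss above \<open>s\<^sup>2\<close>, contradicting
  minimality. By the separation of the true centers, assigning to each true center an estimated
  one nearby is a bijection. Since \<open>\<delta> + \<epsilon> \<le> s\<close> (because \<open>c\<^sub>0 \<le> 1\<close>), every point is strictly
  closer to the estimated center matched with its true cluster than to any other. So relabelling
  the true division by the bijection would strictly lower the loss, unless it is the estimated
  division already.
\<close>

section \<open>Means of finite families of vectors\<close>

definition mean_over :: "('i \<Rightarrow> 'a::real_inner) \<Rightarrow> 'i set \<Rightarrow> 'a" where
  "mean_over y S = (\<Sum>i\<in>S. y i) /\<^sub>R real (card S)"

lemma card_scaleR_mean_over:
  assumes "finite S" "S \<noteq> {}"
  shows "real (card S) *\<^sub>R mean_over y S = (\<Sum>i\<in>S. y i)"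
  using assms by (simp add: mean_over_def)

lemma mean_over_add: "mean_over (\<lambda>i. x i + y i) S = mean_over x S + mean_over y S"
  by (simp add: mean_over_def sum.distrib scaleR_add_right)

lemma mean_over_diff: "mean_over (\<lambda>i. x i - y i) S = mean_over x S - mean_over y S"
  by (simp add: mean_over_def sum_subtractf scaleR_diff_right)

lemma mean_over_const:
  assumes "finite S" "S \<noteq> {}"
  shows "mean_over (\<lambda>_. a) S = a"
  using assms by (simp add: mean_over_def sum_constant_scaleR)

lemma norm_mean_over_le:
  assumes "finite S" "S \<noteq> {}" "\<And>i. i \<in> S \<Longrightarrow> norm (y i) \<le> B"
  shows "norm (mean_over y S) \<le> B"
proof -
  have "norm (\<Sum>i\<in>S. y i) \<le> real (card S) * B"
    using sum_norm_bound[of S y B] assms(3) by simp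
  moreover have "real (card S) > 0"
    using assms(1,2) by (simp add: card_gt_0_iff)
  ultimately show ?thesis
    by (simp add: mean_over_def field_simps)
qed

text \<open>
  The bias-variance (Huygens) identity: the cross term vanishes because deviations from the mean
  sum to zero.
\<close>

lemma sum_norm_diff_squared_mean_over:
  assumes "finite S" "S \<noteq> {}"
  shows "(\<Sum>i\<in>S. (norm (y i - a))\<^sup>2) =
    (\<Sum>i\<in>S. (norm (y i - mean_over y S))\<^sup>2) + real (card S) * (norm (mean_over y S - a))\<^sup>2"
proof -
  let ?\<mu> = "mean_over y S"
  have "(norm (y i - a))\<^sup>2 = (norm (y i - ?\<mu>))\<^sup>2 + (norm (?\<mu> - a))\<^sup>2
      + 2 * ((y i - ?\<mu>) \<bullet> (?\<mu> - a))" for i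
    by (simp add: power2_norm_eq_inner inner_diff_left inner_diff_right inner_commute)
  moreover have "(\<Sum>i\<in>S. (y i - ?\<mu>) \<bullet> (?\<mu> - a)) = 0"
    using card_scaleR_mean_over[OF assms, of y]
    by (simp add: inner_sum_left[symmetric] sum_subtractf sum_constant_scaleR)
  ultimately show ?thesis
    by (simp add: sum.distrib sum_distrib_left[symmetric])
qed

text \<open>
  Averaging over \<open>S\<close> is an orthogonal projection \<open>P\<close> on families of vectors, and \<open>2P - 1\<close> is a
  reflection, hence an isometry. Concretely, reflecting at the mean keeps the mean and all
  distances to it.
\<close>

lemma sum_norm_reflect_at_mean:
  assumes "finite S" "S \<noteq> {}"
  shows "(\<Sum>i\<in>S. (norm (2 *\<^sub>R mean_over y S - y i))\<^sup>2) = (\<Sum>i\<in>S. (norm (y i))\<^sup>2)"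
proof -
  let ?\<mu> = "mean_over y S"
  let ?z = "\<lambda>i. 2 *\<^sub>R ?\<mu> - y i"
  have mean: "mean_over ?z S = ?\<mu>"
    using assms by (simp add: mean_over_diff mean_over_const scaleR_2)
  have "norm (?z i - ?\<mu>) = norm (y i - ?\<mu>)" for i
    by (simp add: scaleR_2 norm_minus_commute)
  then show ?thesis
    using sum_norm_diff_squared_mean_over[OF assms, of ?z 0]
      sum_norm_diff_squared_mean_over[OF assms, of y 0] mean by simp
qed

section \<open>Divisions as labellings\<close>

definition label :: "('k::finite \<Rightarrow> 'n::finite set) \<Rightarrow> 'n \<Rightarrow> 'k" where
  "label C i = (THE k. i \<in> C k)"

lemma label_eq_iff:
  assumes "is_division C"
  shows "label C i = k \<longleftrightarrow> i \<in> C k"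
proof -
  have "inj C" and cover: "\<Union>(range C) = UNIV" and disj: "disjoint (range C)"
    using assms by (auto simp: is_division_def partition_on_def)
  have uniq: "k = l" if "i \<in> C k" "i \<in> C l" for k l
    using disjointD[OF disj, of "C k" "C l"] that \<open>inj C\<close> by (auto dest: injD)
  moreover obtain l where "i \<in> C l"
    using cover by blast
  ultimately have "i \<in> C (label C i)"
    unfolding label_def by (metis theI)
  then show ?thesis
    using uniq by blast
qed

lemma division_nonempty: "is_division C \<Longrightarrow> C k \<noteq> {}"
  by (auto simp: is_division_def partition_on_def)

lemma sum_over_division:
  assumes "is_division C"
  shows "(\<Sum>k\<in>UNIV. \<Sum>i\<in>C k. g k i) = (\<Sum>i\<in>UNIV. g (label C i) i)"
proof -
  have "(\<Sum>i\<in>C k. g k i) = (\<Sum>i\<in>{i \<in> UNIV. label C i = k}. g (label C i) i)" for k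
    by (rule sum.cong) (auto simp: label_eq_iff[OF assms] dest: label_eq_iff[OF assms, THEN iffD2])
  then show ?thesis
    by (simp only: sum.group finite subset_UNIV)
qed

lemma kmeans_loss_label:
  assumes "is_division C"
  shows "real CARD('n) * kmeans_loss (X :: real ^ 'd ^ 'n) C m =
    (\<Sum>i\<in>UNIV. (norm (X $ i - m (label C i)))\<^sup>2)"
  using sum_over_division[OF assms, of "\<lambda>k i. (norm (X $ i - m k))\<^sup>2"] by (simp add: kmeans_loss_def)

lemma kmeans_minimizer_division: "kmeans_minimizer X C m \<Longrightarrow> is_division C"
  by (simp add: kmeans_minimizer_def is_arg_min_linorder)

lemma kmeans_minimizer_loss_le:
  fixes C D :: "'k::finite \<Rightarrow> 'n::finite set"
  assumes "kmeans_minimizer X C m" "is_division D"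
  shows "kmeans_loss X C m \<le> kmeans_loss X D m'"
  using assms by (auto simp: kmeans_minimizer_def is_arg_min_linorder)

lemma kmeans_minimizer_sum_le:
  fixes C D :: "'k::finite \<Rightarrow> 'n::finite set"
  assumes "kmeans_minimizer X C m" "is_division D"
  shows "(\<Sum>i\<in>UNIV. (norm (X $ i - m (label C i)))\<^sup>2)
    \<le> (\<Sum>i\<in>UNIV. (norm (X $ i - m' (label D i)))\<^sup>2)"
  unfolding kmeans_loss_label[OF kmeans_minimizer_division[OF assms(1)], symmetric]
    kmeans_loss_label[OF assms(2), symmetric]
  using kmeans_minimizer_loss_le[OF assms] by (simp add: mult_left_mono)

section \<open>Optimal centers and optimal assignments\<close>

abbreviation cluster_mean :: "real ^ 'd ^ 'n \<Rightarrow> ('k::finite \<Rightarrow> 'n::finite set) \<Rightarrow> 'k \<Rightarrow> real ^ 'd" where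
  "cluster_mean X C k \<equiv> mean_over (($) X) (C k)"

lemma kmeans_loss_cluster_mean:
  assumes "is_division C"
  shows "kmeans_loss (X :: real ^ 'd ^ 'n) C m = kmeans_loss X C (cluster_mean X C) +
    (\<Sum>k\<in>UNIV. real (card (C k)) * (norm (cluster_mean X C k - m k))\<^sup>2) / real CARD('n)"
  unfolding kmeans_loss_def
  using sum_norm_diff_squared_mean_over[OF finite division_nonempty[OF assms], of "($) X" "m _"]
  by (simp add: sum.distrib add_divide_distrib)

lemma kmeans_loss_cluster_mean_le:
  assumes "is_division C"
  shows "kmeans_loss X C (cluster_mean X C) \<le> kmeans_loss X C m"
  by (subst (2) kmeans_loss_cluster_mean[OF assms]) (simp add: sum_nonneg)

lemma kmeans_minimizer_centers:
  assumes "kmeans_minimizer (X :: real ^ 'd ^ 'n) C m"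
  shows "m = cluster_mean X C"
proof
  fix k
  note div = kmeans_minimizer_division[OF assms]
  let ?t = "\<lambda>k. real (card (C k)) * (norm (cluster_mean X C k - m k))\<^sup>2"
  have "sum ?t UNIV / real CARD('n) \<le> 0"
    using kmeans_minimizer_loss_le[OF assms div, of "cluster_mean X C"]
      kmeans_loss_cluster_mean[OF div, of X m] by simp
  then have "sum ?t UNIV \<le> 0"
    by (simp add: divide_le_0_iff)
  then have "?t k = 0"
    using sum_nonneg_eq_0_iff[of UNIV ?t] sum_nonneg[of UNIV ?t] by force
  then show "m k = cluster_mean X C k"
    using division_nonempty[OF div, of k] by simp
qed

text \<open>
  All points are reassigned at once, to a division \<open>D\<close> whose clusters are known to be nonempty:
  moving a single point to its nearest center may empty a cluster and leave the set of divisions.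
\<close>

lemma kmeans_minimizer_eq_nearest_division:
  fixes C D :: "'k::finite \<Rightarrow> 'n::finite set"
  assumes min: "kmeans_minimizer X C m" and D: "is_division D"
    and near: "\<And>i l. l \<noteq> label D i \<Longrightarrow> norm (X $ i - m (label D i)) < norm (X $ i - m l)"
  shows "C = D"
proof -
  let ?g = "\<lambda>B i. (norm (X $ i - m (label B i)))\<^sup>2"
  have less: "?g D i < ?g C i" if "label C i \<noteq> label D i" for i
    using near[OF that] by (simp add: power_strict_mono)
  have le: "?g D i \<le> ?g C i" for i
    by (cases "label C i = label D i") (simp, rule less_imp_le[OF less])
  have "label C i = label D i" for i
  proof (rule ccontr)
    assume "label C i \<noteq> label D i"
    then have "sum (?g D) UNIV < sum (?g C) UNIV"
      by (intro sum_strict_mono_ex1) (use less le in \<open>simp, blast+\<close>)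
    then show False
      using kmeans_minimizer_sum_le[OF min D, of m] by simp
  qed
  then have "i \<in> C k \<longleftrightarrow> i \<in> D k" for i k
    using label_eq_iff[OF D, of i k] label_eq_iff[OF kmeans_minimizer_division[OF min], of i k]
    by simp
  then show ?thesis
    by blast
qed

lemma sum_norm_reflect_at_cluster_mean:
  assumes "is_division C"
  shows "(\<Sum>i\<in>UNIV. (norm (2 *\<^sub>R cluster_mean X C (label C i) - X $ i))\<^sup>2)
    = (\<Sum>i\<in>UNIV. (norm (X $ i))\<^sup>2)"
  unfolding sum_over_division[OF assms, of "\<lambda>k i. (norm (2 *\<^sub>R cluster_mean X C k - X $ i))\<^sup>2", symmetric]
    sum_over_division[OF assms, of "\<lambda>k i. (norm (X $ i))\<^sup>2", symmetric]
  by (simp add: sum_norm_reflect_at_mean division_nonempty[OF assms])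

section \<open>The loss of the estimate on clean data\<close>

text \<open>
  Useful when the perturbation is large: clean points deviate from their own cluster means by at
  most \<open>1\<close> in mean square, and averaging the perturbation moves each mean by at most \<open>\<epsilon>\<close>.
\<close>

lemma kmeans_loss_perturbed_means_le:
  fixes X Y :: "real ^ 'd ^ 'n"
  assumes div: "is_division C"
    and bound: "\<And>i. norm (X $ i) \<le> 1" and close: "\<And>i. norm (Y $ i - X $ i) \<le> \<epsilon>"
  shows "kmeans_loss X C (cluster_mean Y C) \<le> 1 + \<epsilon>\<^sup>2"
proof -
  have "(\<Sum>i\<in>C k. (norm (X $ i - cluster_mean Y C k))\<^sup>2) \<le> (\<Sum>i\<in>C k. 1 + \<epsilon>\<^sup>2)" for k
  proof -
    note huygens = sum_norm_diff_squared_mean_over[OF finite division_nonempty[OF div], of "($) X" _ k]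
    have "norm (cluster_mean X C k - cluster_mean Y C k) \<le> \<epsilon>"
      unfolding mean_over_diff[symmetric] using close
      by (intro norm_mean_over_le) (auto simp: division_nonempty[OF div] norm_minus_commute)
    then have "(norm (cluster_mean X C k - cluster_mean Y C k))\<^sup>2 \<le> \<epsilon>\<^sup>2"
      by (simp add: power_mono)
    then have "real (card (C k)) * (norm (cluster_mean X C k - cluster_mean Y C k))\<^sup>2
        \<le> real (card (C k)) * \<epsilon>\<^sup>2"
      by (simp add: mult_left_mono)
    moreover have "(\<Sum>i\<in>C k. (norm (X $ i - cluster_mean X C k))\<^sup>2) \<le> (\<Sum>i\<in>C k. (norm (X $ i))\<^sup>2)"
      using huygens[of 0] by simp
    moreover have "(\<Sum>i\<in>C k. (norm (X $ i))\<^sup>2) \<le> (\<Sum>i\<in>C k. 1)"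
      using bound by (intro sum_mono) (simp add: power_le_one)
    ultimately show ?thesis
      using huygens[of "cluster_mean Y C k"] by (simp add: algebra_simps)
  qed
  then have "(\<Sum>k\<in>UNIV. \<Sum>i\<in>C k. (norm (X $ i - cluster_mean Y C k))\<^sup>2)
      \<le> (\<Sum>k\<in>UNIV. \<Sum>i\<in>C k. 1 + \<epsilon>\<^sup>2)"
    by (rule sum_mono)
  also have "\<dots> = real CARD('n) * (1 + \<epsilon>\<^sup>2)"
    using sum_over_division[OF div, of "\<lambda>_ _. 1 + \<epsilon>\<^sup>2"] by simp
  finally show ?thesis
    by (simp add: kmeans_loss_def field_simps)
qed

text \<open>
  Useful when the perturbation is small. Replacing each pairing with the perturbation by its
  Cauchy--Schwarz bound is affordable only after the clean means of both divisions have been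
  rewritten as reflections of the data, whose mean square is that of the data.
\<close>

lemma kmeans_minimizer_clean_loss_le:
  fixes X Y :: "real ^ 'd ^ 'n" and C Chat :: "'k::finite \<Rightarrow> 'n set"
  assumes min: "kmeans_minimizer Y Chat mhat" and C: "is_division C"
    and bound: "\<And>i. norm (X $ i) \<le> 1" and close: "\<And>i. norm (Y $ i - X $ i) \<le> \<epsilon>"
  shows "kmeans_loss X Chat mhat \<le> kmeans_loss X C m + 2 * \<epsilon> + 2 * \<epsilon>\<^sup>2"
proof -
  note Chat = kmeans_minimizer_division[OF min]
  have \<epsilon>: "0 \<le> \<epsilon>"
    using close norm_ge_zero order_trans by blast
  define e where "e i = Y $ i - X $ i" for i
  define a where "a i = mhat (label Chat i)" for i
  define p where "p i = cluster_mean X Chat (label Chat i)" for i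
  define q where "q i = mean_over e (Chat (label Chat i))" for i
  define b where "b i = cluster_mean X C (label C i)" for i
  define R where "R z i = 2 *\<^sub>R z i - X $ i" for z i
  have e: "norm (e i) \<le> \<epsilon>" for i
    using close by (simp add: e_def)
  have a: "a i = p i + q i" for i
  proof -
    have "($) Y = (\<lambda>i. X $ i + e i)"
      by (simp add: e_def)
    then show ?thesis
      unfolding a_def p_def q_def kmeans_minimizer_centers[OF min] by (simp add: mean_over_add)
  qed
  have R: "(\<Sum>i\<in>UNIV. (norm (R z i))\<^sup>2) \<le> real CARD('n)" if "z = p \<or> z = b" for z
  proof -
    have "(\<Sum>i\<in>UNIV. (norm (R z i))\<^sup>2) = (\<Sum>i\<in>UNIV. (norm (X $ i))\<^sup>2)"
      using that sum_norm_reflect_at_cluster_mean[OF Chat, of X]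
        sum_norm_reflect_at_cluster_mean[OF C, of X]
      by (auto simp: R_def p_def b_def)
    also have "\<dots> \<le> (\<Sum>i\<in>(UNIV :: 'n set). 1)"
      using bound by (intro sum_mono) (simp add: power_le_one)
    finally show ?thesis
      by simp
  qed
  \<comment> \<open>Cauchy--Schwarz leaves the norms of the two reflections; \<open>2 t \<le> t\<^sup>2 + 1\<close> turns them into
    squares, whose sum over \<open>i\<close> is known. The summand \<open>\<epsilon>\<close> comes from the two constants \<open>1\<close>.\<close>
  have pairing: "2 * ((a i - b i) \<bullet> e i) \<le>
      \<epsilon> / 2 * ((norm (R p i))\<^sup>2 + (norm (R b i))\<^sup>2) + (\<epsilon> + 2 * \<epsilon>\<^sup>2)" for i
  proof -
    have "2 * ((a i - b i) \<bullet> e i) = R p i \<bullet> e i + R b i \<bullet> (- e i) + 2 * (q i \<bullet> e i)"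
      unfolding a R_def by (simp add: inner_diff_left inner_add_left)
    moreover have "z \<bullet> w \<le> \<epsilon> / 2 * (norm z)\<^sup>2 + \<epsilon> / 2" if "norm w \<le> \<epsilon>" for z w :: "real ^ 'd"
    proof -
      have "z \<bullet> w \<le> norm z * norm w"
        by (rule norm_cauchy_schwarz)
      also have "\<dots> \<le> \<epsilon> * norm z"
        using that by (metis mult.commute mult_right_mono norm_ge_zero)
      also have "\<dots> \<le> \<epsilon> * (((norm z)\<^sup>2 + 1) / 2)"
        using sum_squares_bound[of "norm z" 1] \<epsilon> by (intro mult_left_mono) simp_all
      finally show ?thesis
        by (simp add: field_simps)
    qed
    from this[of "e i" "R p i"] this[of "- e i" "R b i"]
    have "R p i \<bullet> e i + R b i \<bullet> (- e i) \<le> \<epsilon> / 2 * ((norm (R p i))\<^sup>2 + (norm (R b i))\<^sup>2) + \<epsilon>"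
      using e[of i] by (simp add: algebra_simps)
    moreover have "q i \<bullet> e i \<le> \<epsilon>\<^sup>2"
    proof -
      have "norm (q i) \<le> \<epsilon>"
        unfolding q_def using e by (intro norm_mean_over_le) (auto simp: division_nonempty[OF Chat])
      then have "norm (q i) * norm (e i) \<le> \<epsilon> * \<epsilon>"
        using e[of i] \<epsilon> by (intro mult_mono) auto
      then show ?thesis
        using norm_cauchy_schwarz[of "q i" "e i"] by (simp add: power2_eq_square)
    qed
    ultimately show ?thesis
      by linarith
  qed
  \<comment> \<open>Clean loss at \<open>a\<close>, minus denoised loss at \<open>a\<close>, plus denoised loss at \<open>b\<close>: by minimality
    this bounds the clean loss at \<open>a\<close> on average, and the squares of \<open>e\<close> cancel.\<close>
  have split: "(norm (X $ i - a i))\<^sup>2 - (norm (Y $ i - a i))\<^sup>2 + (norm (Y $ i - b i))\<^sup>2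
      = (norm (X $ i - b i))\<^sup>2 + 2 * ((a i - b i) \<bullet> e i)" for i
    unfolding e_def
    by (simp add: power2_norm_eq_inner inner_diff_left inner_diff_right inner_commute)
  have "(\<Sum>i\<in>UNIV. (norm (X $ i - a i))\<^sup>2)
      \<le> (\<Sum>i\<in>UNIV. (norm (X $ i - a i))\<^sup>2 - (norm (Y $ i - a i))\<^sup>2 + (norm (Y $ i - b i))\<^sup>2)"
    using kmeans_minimizer_sum_le[OF min C, of "cluster_mean X C"]
    by (simp add: a_def b_def sum.distrib sum_subtractf)
  also have "\<dots> \<le> (\<Sum>i\<in>UNIV. (norm (X $ i - b i))\<^sup>2 +
      (\<epsilon> / 2 * ((norm (R p i))\<^sup>2 + (norm (R b i))\<^sup>2) + (\<epsilon> + 2 * \<epsilon>\<^sup>2)))"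
    unfolding split using pairing by (intro sum_mono) simp
  also have "\<dots> = (\<Sum>i\<in>UNIV. (norm (X $ i - b i))\<^sup>2)
      + \<epsilon> / 2 * ((\<Sum>i\<in>UNIV. (norm (R p i))\<^sup>2) + (\<Sum>i\<in>UNIV. (norm (R b i))\<^sup>2))
      + real CARD('n) * (\<epsilon> + 2 * \<epsilon>\<^sup>2)"
    by (simp only: sum.distrib sum_distrib_left[symmetric] sum_constant add.assoc distrib_left)
  also have "\<dots> \<le> (\<Sum>i\<in>UNIV. (norm (X $ i - b i))\<^sup>2)
      + \<epsilon> / 2 * (real CARD('n) + real CARD('n)) + real CARD('n) * (\<epsilon> + 2 * \<epsilon>\<^sup>2)"
    using R \<epsilon> by (intro add_mono mult_left_mono) auto
  finally have "real CARD('n) * kmeans_loss X Chat mhat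
      \<le> real CARD('n) * (kmeans_loss X C (cluster_mean X C) + 2 * \<epsilon> + 2 * \<epsilon>\<^sup>2)"
    by (simp add: kmeans_loss_label[OF Chat] kmeans_loss_label[OF C] a_def b_def algebra_simps)
  then have "kmeans_loss X Chat mhat \<le> kmeans_loss X C (cluster_mean X C) + 2 * \<epsilon> + 2 * \<epsilon>\<^sup>2"
    by simp
  with kmeans_loss_cluster_mean_le[OF C, of X m] show ?thesis
    by simp
qed

section \<open>Exact recovery of separated clusters\<close>

text \<open>
  A cluster of at least \<open>c\<^sub>0 n\<close> points would be too expensive for the estimate if no estimated
  center came close to it.
\<close>

lemma kmeans_minimizer_center_near:
  fixes Y :: "real ^ 'd ^ 'n" and C Chat :: "'k::finite \<Rightarrow> 'n set"
  assumes min: "kmeans_minimizer Y Chat mhat" and C: "is_division C"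
    and large: "real (card (C k)) \<ge> c\<^sub>0 * real CARD('n)"
    and close: "\<And>k i. i \<in> C k \<Longrightarrow> norm (Y $ i - m k) \<le> \<rho>"
    and s: "0 \<le> s" "\<rho>\<^sup>2 \<le> c\<^sub>0 * s\<^sup>2"
  shows "\<exists>j. norm (mhat j - m k) \<le> \<rho> + s"
proof (rule ccontr)
  assume "\<not> ?thesis"
  then have far: "norm (mhat j - m k) > \<rho> + s" for j
    by (simp add: not_le)
  let ?g = "\<lambda>i. (norm (Y $ i - mhat (label Chat i)))\<^sup>2"
  have "s\<^sup>2 < ?g i" if "i \<in> C k" for i
  proof -
    have "norm (mhat (label Chat i) - m k) \<le> norm (Y $ i - mhat (label Chat i)) + norm (Y $ i - m k)"
      using norm_triangle_ineq[of "mhat (label Chat i) - Y $ i" "Y $ i - m k"]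
      by (simp add: norm_minus_commute)
    then have "s < norm (Y $ i - mhat (label Chat i))"
      using far[of "label Chat i"] close[OF that] by simp
    then show ?thesis
      using s(1) by (simp add: power_strict_mono)
  qed
  then have "(\<Sum>i\<in>C k. s\<^sup>2) < (\<Sum>i\<in>C k. ?g i)"
    using division_nonempty[OF C] by (intro sum_strict_mono) auto
  also have "\<dots> \<le> (\<Sum>i\<in>UNIV. ?g i)"
    by (intro sum_mono2) auto
  also have "\<dots> \<le> (\<Sum>i\<in>UNIV. (norm (Y $ i - m (label C i)))\<^sup>2)"
    by (rule kmeans_minimizer_sum_le[OF min C])
  also have "\<dots> \<le> (\<Sum>i\<in>(UNIV :: 'n set). \<rho>\<^sup>2)"
    using close label_eq_iff[OF C] by (intro sum_mono power_mono) auto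
  also have "\<dots> \<le> real CARD('n) * (c\<^sub>0 * s\<^sup>2)"
    using s(2) by simp
  also have "\<dots> \<le> (\<Sum>i\<in>C k. s\<^sup>2)"
    using mult_right_mono[OF large, of "s\<^sup>2"] by (simp add: mult_ac)
  finally show False
    by simp
qed

text \<open>
  The estimated center matched with the cluster of a point is within \<open>2\<rho> + s\<close> of that point, and
  every other one is at distance at least \<open>c\<^sub>m - (2\<rho> + s)\<close>, which is more.
\<close>

lemma kmeans_minimizer_recovers_division:
  fixes Y :: "real ^ 'd ^ 'n" and C Chat :: "'k::finite \<Rightarrow> 'n set"
  assumes min: "kmeans_minimizer Y Chat mhat" and C: "is_division C"
    and large: "\<And>k. real (card (C k)) \<ge> c\<^sub>0 * real CARD('n)"
    and close: "\<And>k i. i \<in> C k \<Longrightarrow> norm (Y $ i - m k) \<le> \<rho>"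
    and s: "0 \<le> s" "\<rho>\<^sup>2 \<le> c\<^sub>0 * s\<^sup>2"
    and sep: "\<And>j k. j \<noteq> k \<Longrightarrow> norm (m j - m k) \<ge> c\<^sub>m"
    and c: "c\<^sub>m > 2 * (2 * \<rho> + s)"
  shows "range Chat = range C"
proof -
  have \<rho>: "0 \<le> \<rho>"
  proof -
    obtain i where "i \<in> C undefined"
      using division_nonempty[OF C] by blast
    then show ?thesis
      using close order_trans[OF norm_ge_zero] by blast
  qed
  have "\<exists>j. norm (mhat j - m k) \<le> \<rho> + s" for k
    using kmeans_minimizer_center_near[OF min C large _ s, of m k] close by blast
  then obtain j where j: "norm (mhat (j k) - m k) \<le> \<rho> + s" for k
    by metis
  have "inj j"
  proof (rule injI, rule ccontr)
    fix k l
    assume "j k = j l" "k \<noteq> l"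
    then have "norm (m k - m l) \<le> norm (mhat (j k) - m k) + norm (mhat (j l) - m l)"
      using norm_triangle_ineq[of "m k - mhat (j k)" "mhat (j k) - m l"]
      by (simp add: norm_minus_commute)
    then show False
      using j[of k] j[of l] sep[OF \<open>k \<noteq> l\<close>] c \<rho> by simp
  qed
  then have "bij j"
    by (simp add: bij_def finite_UNIV_inj_surj)
  \<comment> \<open>The division to be recovered, relabelled by the estimated centers.\<close>
  define D where "D = C \<circ> inv j"
  have range: "range D = range C"
    unfolding D_def image_comp[symmetric] using \<open>bij j\<close> by (simp add: bij_imp_bij_inv bij_is_surj)
  have D: "is_division D"
    using C \<open>bij j\<close> range unfolding is_division_def
    by (simp add: D_def inj_compose bij_imp_bij_inv bij_is_inj)
  have label: "label D i = j (label C i)" for i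
    using label_eq_iff[OF C, of i "label C i"] \<open>inj j\<close>
    unfolding label_eq_iff[OF D] by (simp add: D_def)
  have "Chat = D"
  proof (rule kmeans_minimizer_eq_nearest_division[OF min D])
    fix i l
    assume l: "l \<noteq> label D i"
    let ?k = "label C i"
    have Y: "norm (Y $ i - m ?k) \<le> \<rho>"
      using close label_eq_iff[OF C] by blast
    obtain k' where k': "l = j k'"
      using \<open>bij j\<close> by (metis bij_pointE)
    with l label have "k' \<noteq> ?k"
      by auto
    then have "c\<^sub>m \<le> norm (m k' - m ?k)"
      by (rule sep)
    also have "\<dots> \<le> norm (mhat l - m k') + norm (Y $ i - mhat l) + norm (Y $ i - m ?k)"
      using norm_triangle_ineq[of "m k' - mhat l" "mhat l - Y $ i"]
        norm_triangle_ineq[of "m k' - Y $ i" "Y $ i - m ?k"]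
      by (simp add: norm_minus_commute)
    finally have "c\<^sub>m - (2 * \<rho> + s) \<le> norm (Y $ i - mhat l)"
      using j[of k'] Y k' by simp
    moreover have "norm (Y $ i - mhat (label D i)) \<le> 2 * \<rho> + s"
      using norm_triangle_ineq[of "Y $ i - m ?k" "m ?k - mhat (j ?k)"] j[of ?k] Y
      by (simp add: label norm_minus_commute)
    ultimately show "norm (Y $ i - mhat (label D i)) < norm (Y $ i - mhat l)"
      using c by simp
  qed
  with range show ?thesis
    by simp
qed

section \<open>Clustering of denoised data\<close>

lemma norm_row_le_norm_2_inf: "norm (A $ i) \<le> norm_2_inf A"
  by (simp add: norm_2_inf_def)

theorem proposition3:
  fixes X \<Xi> Z Xhat :: "real ^ 'd ^ 'n"
    and C Chat :: "'k::finite \<Rightarrow> 'n set"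
    and mhat :: "'k \<Rightarrow> real ^ 'd"
    and \<sigma> :: "nat \<Rightarrow> real"
    and u :: "nat \<Rightarrow> real ^ 'n"
    and v :: "nat \<Rightarrow> real ^ 'd"
    and \<epsilon> :: real
  assumes "\<And>i. norm (X $ i) \<le> 1"
    and "Z = X + \<Xi>"
    and "is_svd Z \<sigma> u v"
    and "Xhat = pca_denoise (rank X) v Z"
    and "norm_2_inf (Xhat - X) \<le> \<epsilon>"
    and "is_division C"
    and "kmeans_minimizer Xhat Chat mhat"
  shows "(\<epsilon> \<le> 2 + sqrt 3 \<longrightarrow>
            (\<forall>m :: 'k \<Rightarrow> real ^ 'd. kmeans_loss X Chat mhat \<le> kmeans_loss X C m + 4 * \<epsilon>))
       \<and> (\<forall>(m :: 'k \<Rightarrow> real ^ 'd) c\<^sub>0 \<delta> c\<^sub>m.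
            c\<^sub>0 > 0 \<and>
            (\<forall>k. real (card (C k)) \<ge> c\<^sub>0 * real CARD('n)) \<and>
            (\<forall>k. \<forall>i\<in>C k. norm (X $ i - m k) \<le> \<delta>) \<and>
            (\<forall>j k. j \<noteq> k \<longrightarrow> norm (m j - m k) \<ge> c\<^sub>m) \<and>
            c\<^sub>m > 2 * (\<delta> + \<epsilon> + 2 * sqrt (2 * (\<delta>\<^sup>2 + \<epsilon>\<^sup>2) / c\<^sub>0))
            \<longrightarrow> range Chat = range C)"
proof (intro conjI impI allI)
  note min = \<open>kmeans_minimizer Xhat Chat mhat\<close> and C = \<open>is_division C\<close>
  have close: "norm (Xhat $ i - X $ i) \<le> \<epsilon>" for i
    using norm_row_le_norm_2_inf[of "Xhat - X" i] \<open>norm_2_inf (Xhat - X) \<le> \<epsilon>\<close> by simp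
  have \<epsilon>: "0 \<le> \<epsilon>"
    using close norm_ge_zero order_trans by blast
  {
    fix m :: "'k \<Rightarrow> real ^ 'd"
    assume le: "\<epsilon> \<le> 2 + sqrt 3"
    show "kmeans_loss X Chat mhat \<le> kmeans_loss X C m + 4 * \<epsilon>"
    proof (cases "\<epsilon> \<le> 1")
      case True
      then have "\<epsilon>\<^sup>2 \<le> \<epsilon>"
        using \<epsilon> by (simp add: power2_eq_square mult_left_le)
      then show ?thesis
        using kmeans_minimizer_clean_loss_le[OF min C assms(1) close, of m] by simp
    next
      case False
      moreover have "1 \<le> sqrt (3 :: real)"
        by simp
      ultimately have "\<bar>\<epsilon> - 2\<bar> \<le> sqrt 3"
        using le by linarith
      then have "(\<epsilon> - 2)\<^sup>2 \<le> 3"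
        using power_mono[of "\<bar>\<epsilon> - 2\<bar>" "sqrt 3" 2] by simp
      then have "1 + \<epsilon>\<^sup>2 \<le> 4 * \<epsilon>"
        by (simp add: power2_eq_square algebra_simps)
      moreover have "0 \<le> kmeans_loss X C m"
        by (simp add: kmeans_loss_def sum_nonneg)
      ultimately show ?thesis
        using kmeans_loss_perturbed_means_le[OF kmeans_minimizer_division[OF min] assms(1) close]
        by (simp add: kmeans_minimizer_centers[OF min, symmetric])
    qed
  next
    fix m :: "'k \<Rightarrow> real ^ 'd" and c\<^sub>0 \<delta> c\<^sub>m
    let ?s = "sqrt (2 * (\<delta>\<^sup>2 + \<epsilon>\<^sup>2) / c\<^sub>0)"
    assume "c\<^sub>0 > 0 \<and>
            (\<forall>k. real (card (C k)) \<ge> c\<^sub>0 * real CARD('n)) \<and>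
            (\<forall>k. \<forall>i\<in>C k. norm (X $ i - m k) \<le> \<delta>) \<and>
            (\<forall>j k. j \<noteq> k \<longrightarrow> norm (m j - m k) \<ge> c\<^sub>m) \<and>
            c\<^sub>m > 2 * (\<delta> + \<epsilon> + 2 * ?s)"
    then have c0: "c\<^sub>0 > 0" and large: "\<And>k. real (card (C k)) \<ge> c\<^sub>0 * real CARD('n)"
      and \<delta>: "\<And>k i. i \<in> C k \<Longrightarrow> norm (X $ i - m k) \<le> \<delta>"
      and sep: "\<And>j k. j \<noteq> k \<Longrightarrow> norm (m j - m k) \<ge> c\<^sub>m"
      and c: "c\<^sub>m > 2 * (\<delta> + \<epsilon> + 2 * ?s)"
      by auto
    have s: "0 \<le> ?s" "c\<^sub>0 * ?s\<^sup>2 = 2 * (\<delta>\<^sup>2 + \<epsilon>\<^sup>2)"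
      using c0 by simp_all
    have near: "norm (Xhat $ i - m k) \<le> \<delta> + \<epsilon>" if "i \<in> C k" for i k
      using norm_triangle_ineq[of "Xhat $ i - X $ i" "X $ i - m k"] close[of i] \<delta>[OF that] by simp
    have sq: "(\<delta> + \<epsilon>)\<^sup>2 \<le> c\<^sub>0 * ?s\<^sup>2"
      unfolding s(2) using sum_squares_bound[of \<delta> \<epsilon>] by (simp add: power2_sum)
    have "c\<^sub>0 \<le> 1"
    proof -
      have "c\<^sub>0 * real CARD('n) \<le> real (card (C undefined))"
        by (rule large)
      also have "\<dots> \<le> 1 * real CARD('n)"
        by (simp add: card_mono)
      finally show ?thesis
        by (simp only: mult_le_cancel_right_pos zero_less_card_finite of_nat_0_less_iff)
    qed
    then have "c\<^sub>0 * ?s\<^sup>2 \<le> ?s\<^sup>2"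
      by (intro mult_left_le_one_le) (use c0 in auto)
    with sq have "(\<delta> + \<epsilon>)\<^sup>2 \<le> ?s\<^sup>2"
      by simp
    then have "\<delta> + \<epsilon> \<le> ?s"
      using s(1) by (rule power2_le_imp_le)
    then have "c\<^sub>m > 2 * (2 * (\<delta> + \<epsilon>) + ?s)"
      using c by simp
    then show "range Chat = range C"
      using kmeans_minimizer_recovers_division[OF min C large _ s(1) sq, of m c\<^sub>m] near sep by blast
  }
qed

end
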